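(* Let $p,q>1$ and let $a,b\in\mathbb{R}$ satisfy either $a\ge0\ge b$, or ($0<b\le a$ and $a\le1$). Then $\mathrm{arsinh}_{p,q}$ is $(a,b)$-concave on $(0,\infty)$; in particular, if $p=q$, then the function $\mathrm{arsinh}_p=\mathrm{arsinh}_{p,p}$ is $(a,b)$-concave on $(0,\infty)$. In other words, for all such $p,q,a,b$ and all $r,s\in(0,\infty)$, $$\mathrm{arsinh}_{p,q}(M_a(r,s))\ge M_b(\mathrm{arsinh}_{p,q}(r),\mathrm{arsinh}_{p,q}(s)).$$
   Context: Power means: for $a\in\mathbb{R}$ and $x,y>0$, $M_a(x,y)=\left(\frac{x^a+y^a}{2}\right)^{1/a}$ if $a\ne0$, and $M_0(x,y)=\sqrt{xy}$. For an interval $I\subset(0,\infty)$, a continuous function $f:I\to(0,\infty)$ and $a,b\in\mathbb{R}$, $f$ is called $(a,b)$-concave on $I$ if $f(M_a(x,y))\ge M_b(f(x),f(y))$ for all $x,y\in I$. For $p,q>1$ and $x\in(0,\infty)$, $\mathrm{arsinh}_{p,q}(x)=\int_0^x(1+t^q)^{-1/p}\,dt$. *)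

theory Defs
  imports "HOL-Analysis.Analysis"
begin

text \<open>The power mean of order \<open>a\<close>; it is only meant for positive arguments \<open>x\<close> and \<open>y\<close>.\<close>

definition power_mean :: "real \<Rightarrow> real \<Rightarrow> real \<Rightarrow> real" where
  "power_mean a x y =
     (if a = 0 then sqrt (x * y) else ((x powr a + y powr a) / 2) powr (1 / a))"

text \<open>The standing assumptions (an interval of positive reals, and a continuous positive
  function on it) are part of the predicate.\<close>

definition power_mean_concave_on :: "real \<Rightarrow> real \<Rightarrow> real set \<Rightarrow> (real \<Rightarrow> real) \<Rightarrow> bool" where
  "power_mean_concave_on a b I f \<longleftrightarrow>
     is_interval I \<and> I \<subseteq> {0<..} \<and> continuous_on I f \<and> f ` I \<subseteq> {0<..} \<and>
     (\<forall>x\<in>I. \<forall>y\<in>I. f (power_mean a x y) \<ge> power_mean b (f x) (f y))"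

text \<open>The integrand is continuous on the closed interval from \<open>0\<close> to \<open>x\<close>
  (\<open>0 powr q = 0\<close>), so the choice of integral is immaterial. Only arguments \<open>x > 0\<close>
  are meant.\<close>

definition arsinh_pq :: "real \<Rightarrow> real \<Rightarrow> real \<Rightarrow> real" where
  "arsinh_pq p q x = integral {0..x} (\<lambda>t. (1 + t powr q) powr (- 1 / p))"

definition arsinh_p :: "real \<Rightarrow> real \<Rightarrow> real" where
  "arsinh_p p = arsinh_pq p p"

end

theory Submission imports Defs begin

text \<open>Write \<open>F\<close> for the function and \<open>w\<close> for its derivative. After the substitution
  \<open>x = u powr (1 / b)\<close> the power \<open>F x powr b\<close> has derivative
  \<open>(x * w x / F x) powr (1 - b) * w x powr b\<close> in \<open>u\<close>, and \<open>ln (F (exp u))\<close> has derivative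
  \<open>x * w x / F x\<close> at \<open>x = exp u\<close>. So if both \<open>w\<close> and the elasticity \<open>x * w x / F x\<close> decrease,
  then \<open>F\<close> is \<open>(b, b)\<close>-concave for \<open>0 \<le> b \<le> 1\<close>. Since \<open>F\<close> increases and power means
  increase with their order, this gives \<open>(a, b)\<close>-concavity through an intermediate order.
  The elasticity of \<open>arsinh_pq\<close> decreases because it is the reciprocal of the integral of
  \<open>w (s * x) / w x\<close> over \<open>s\<close> from \<open>0\<close> to \<open>1\<close>, whose integrand increases with \<open>x\<close>.\<close>

subsection \<open>Monotonicity of power means in the order\<close>

lemma power_mean_pos:
  assumes "x > 0" "y > 0"
  shows "power_mean a x y > 0"
proof -
  have "(x powr a + y powr a) / 2 > 0"
    using assms by (intro divide_pos_pos add_pos_pos) auto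
  then show ?thesis
    using assms by (simp add: power_mean_def)
qed

lemma sqrt_mult_le_power_mean:
  assumes "x > 0" "y > 0" "a \<ge> 0"
  shows "sqrt (x * y) \<le> power_mean a x y"
proof (cases "a = 0")
  case False
  with assms have a: "a > 0" by simp
  have "sqrt (x * y) = sqrt (x powr a * y powr a) powr (1 / a)"
    using assms a by (simp add: powr_half_sqrt[symmetric] powr_powr powr_mult)
  also have "\<dots> \<le> ((x powr a + y powr a) / 2) powr (1 / a)"
    using a by (intro powr_mono2 arith_geo_mean_sqrt) auto
  finally show ?thesis
    using a by (simp add: power_mean_def)
qed (simp add: power_mean_def)

text \<open>Inverting the arguments reverses the sign of the order, which carries lower bounds for
  orders \<ge> 0 over to upper bounds for orders \<le> 0.\<close>

lemma power_mean_uminus: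
  assumes "x > 0" "y > 0"
  shows "power_mean (- a) x y = inverse (power_mean a (inverse x) (inverse y))"
  using assms by (simp add: power_mean_def powr_minus inverse_powr real_sqrt_inverse real_sqrt_mult)

lemma power_mean_le_sqrt_mult:
  assumes "x > 0" "y > 0" "b \<le> 0"
  shows "power_mean b x y \<le> sqrt (x * y)"
proof -
  have "sqrt (inverse x * inverse y) \<le> power_mean (- b) (inverse x) (inverse y)"
    using assms by (intro sqrt_mult_le_power_mean) auto
  then have "inverse (power_mean (- b) (inverse x) (inverse y)) \<le> inverse (sqrt (inverse x * inverse y))"
    using assms by (intro le_imp_inverse_le) auto
  then show ?thesis
    using power_mean_uminus[of x y "- b"] assms by (simp add: real_sqrt_inverse real_sqrt_mult)
qed

text \<open>Jensen's inequality at the midpoint of \<open>x powr b\<close> and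
  \<open>y powr b\<close> for the power with exponent \<open>a / b\<close> \<ge> 1, followed by an
  \<open>a\<close>-th root.\<close>

lemma power_mean_mono_pos:
  assumes "x > 0" "y > 0" "0 < b" "b \<le> a"
  shows "power_mean b x y \<le> power_mean a x y"
proof -
  have "((1 - 1/2) *\<^sub>R x powr b + (1/2) *\<^sub>R y powr b) powr (a / b)
      \<le> (1 - 1/2) * (x powr b) powr (a / b) + (1/2) * (y powr b) powr (a / b)"
    using assms by (intro convex_onD[OF powr_convex]) auto
  then have "((x powr b + y powr b) / 2) powr (a / b) \<le> (x powr a + y powr a) / 2"
    using assms by (simp add: powr_powr add_divide_distrib)
  then have "(((x powr b + y powr b) / 2) powr (a / b)) powr (1 / a)
      \<le> ((x powr a + y powr a) / 2) powr (1 / a)"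
    using assms by (intro powr_mono2) auto
  then show ?thesis
    using assms by (simp add: power_mean_def powr_powr)
qed

subsection \<open>Concavity of functions with decreasing elasticity\<close>

lemma convex_on_uminus_midpoint:
  fixes g :: "real \<Rightarrow> real"
  assumes "convex_on A (\<lambda>u. - g u)" "u \<in> A" "v \<in> A"
  shows "(g u + g v) / 2 \<le> g ((u + v) / 2)"
  using convex_onD[OF assms(1), of "1/2" u v] assms(2,3) by (simp add: add_divide_distrib)

text \<open>In logarithmic coordinates on both axes a geometric mean becomes a midpoint and the
  elasticity becomes the slope, so a decreasing elasticity is concavity.\<close>

lemma geometric_mean_concave_if_elasticity_antimono:
  fixes F w :: "real \<Rightarrow> real"
  assumes deriv: "\<And>x. x > 0 \<Longrightarrow> (F has_real_derivative w x) (at x)"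
    and F: "\<And>x. x > 0 \<Longrightarrow> F x > 0"
    and elast: "\<And>x y. 0 < x \<Longrightarrow> x \<le> y \<Longrightarrow> y * w y / F y \<le> x * w x / F x"
    and rs: "r > 0" "s > 0"
  shows "sqrt (F r * F s) \<le> F (sqrt (r * s))"
proof -
  have "convex_on UNIV (\<lambda>u. - ln (F (exp u)))"
  proof (rule convex_on_realI)
    fix u :: real
    show "((\<lambda>u. - ln (F (exp u))) has_real_derivative - (exp u * w (exp u) / F (exp u))) (at u)"
      using F[of "exp u"]
      by (auto intro!: derivative_eq_intros DERIV_chain2[OF deriv] simp: field_simps)
  qed (use elast in auto)
  then have "(ln (F r) + ln (F s)) / 2 \<le> ln (F (exp ((ln r + ln s) / 2)))"
    using convex_on_uminus_midpoint[of UNIV "\<lambda>u. ln (F (exp u))" "ln r" "ln s"] rs by simp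
  also have "exp ((ln r + ln s) / 2) = sqrt (r * s)"
    using rs by (simp add: powr_half_sqrt[symmetric] powr_def ln_mult)
  also have "(ln (F r) + ln (F s)) / 2 = ln (sqrt (F r * F s))"
    using F[OF rs(1)] F[OF rs(2)] by (simp add: real_sqrt_mult ln_mult ln_sqrt)
  finally show ?thesis
    using F rs by simp
qed

lemma power_mean_concave_if_elasticity_antimono:
  fixes F w :: "real \<Rightarrow> real"
  assumes deriv: "\<And>x. x > 0 \<Longrightarrow> (F has_real_derivative w x) (at x)"
    and F: "\<And>x. x > 0 \<Longrightarrow> F x > 0"
    and w: "\<And>x. x > 0 \<Longrightarrow> w x > 0"
    and w_antimono: "\<And>x y. 0 < x \<Longrightarrow> x \<le> y \<Longrightarrow> w y \<le> w x"
    and elast: "\<And>x y. 0 < x \<Longrightarrow> x \<le> y \<Longrightarrow> y * w y / F y \<le> x * w x / F x"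
    and b: "0 < b" "b \<le> 1"
    and rs: "r > 0" "s > 0"
  shows "power_mean b (F r) (F s) \<le> F (power_mean b r s)"
proof -
  \<comment> \<open>This is the derivative of \<open>F x powr b\<close> with respect to
    \<open>u = x powr b\<close>. It is factored so that monotonicity can be read off: both bases
    decrease in \<open>x\<close>, and both exponents are nonnegative because 0 < \<open>b\<close>
    \<le> 1.\<close>
  define d where "d x = (x * w x / F x) powr (1 - b) * w x powr b" for x
  have "convex_on {0<..} (\<lambda>u. - (F (u powr (1 / b)) powr b))"
  proof (rule convex_on_realI)
    fix u :: real assume u: "u \<in> {0<..}"
    define x where "x = u powr (1 / b)"
    have x: "x > 0" "F x > 0" "w x > 0"
      using u F w by (auto simp: x_def)
    have "d x = x powr (1 - b) * w x powr (1 - b) * F x powr (b - 1) * w x powr b"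
      using x by (simp add: d_def powr_mult powr_divide powr_diff)
    also have "\<dots> = x powr (1 - b) * F x powr (b - 1) * (w x powr (1 - b) * w x powr b)"
      by simp
    also have "w x powr (1 - b) * w x powr b = w x"
      using x by (simp flip: powr_add)
    also have "x powr (1 - b) = u powr (1 / b - 1)"
      using b by (simp add: x_def powr_powr field_simps)
    finally have d: "d x = u powr (1 / b - 1) * F x powr (b - 1) * w x" .
    have "((\<lambda>u. u powr (1 / b)) has_real_derivative 1 / b * u powr (1 / b - 1)) (at u)"
      using u by (auto intro!: derivative_eq_intros simp: powr_diff)
    from DERIV_chain2[OF _ this, of F "w x"] deriv x
    have "((\<lambda>u. F (u powr (1 / b))) has_real_derivative w x * (1 / b * u powr (1 / b - 1))) (at u)"
      by (simp add: x_def)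
    from DERIV_chain2[OF _ this, of "\<lambda>y. y powr b" "b * F x powr (b - 1)"]
    have "((\<lambda>u. F (u powr (1 / b)) powr b) has_real_derivative
        b * F x powr (b - 1) * (w x * (1 / b * u powr (1 / b - 1)))) (at u)"
      using x by (simp add: x_def has_real_derivative_powr)
    moreover have "b * F x powr (b - 1) * (w x * (1 / b * u powr (1 / b - 1))) = d x"
      using b by (simp add: d)
    ultimately show "((\<lambda>u. - (F (u powr (1 / b)) powr b)) has_real_derivative
        - d (u powr (1 / b))) (at u)"
      by (auto intro: DERIV_minus simp: x_def)
  next
    fix u v :: real assume uv: "u \<in> {0<..}" "v \<in> {0<..}" "u \<le> v"
    then have "u powr (1 / b) > 0" "u powr (1 / b) \<le> v powr (1 / b)"
      using b by (auto intro: powr_mono2)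
    then have "d (v powr (1 / b)) \<le> d (u powr (1 / b))"
      unfolding d_def using b uv F w less_imp_le[OF F] less_imp_le[OF w]
      by (intro mult_mono powr_mono2 elast w_antimono) auto
    then show "- d (u powr (1 / b)) \<le> - d (v powr (1 / b))"
      by simp
  qed simp
  \<comment> \<open>With \<open>u = r powr b\<close> and \<open>v = s powr b\<close>, the midpoint
    is sent by \<open>u powr (1 / b)\<close> to the power mean of \<open>r\<close> and
    \<open>s\<close> of order \<open>b\<close>.\<close>
  from convex_on_uminus_midpoint[OF this, of "r powr b" "s powr b"]
  have "(F r powr b + F s powr b) / 2 \<le> F (power_mean b r s) powr b"
    using rs b by (simp add: powr_powr power_mean_def)
  then have "((F r powr b + F s powr b) / 2) powr (1 / b) \<le> (F (power_mean b r s) powr b) powr (1 / b)"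
    using b by (intro powr_mono2) auto
  then show ?thesis
    using b rs F[of "power_mean b r s"] by (simp add: powr_powr power_mean_def[of b "F r"] power_mean_pos)
qed

text \<open>For positive \<open>w\<close>, the assumption \<open>cross\<close> says without division
  that \<open>w (c * t) / w t\<close> decreases in \<open>t\<close> for every \<open>c\<close> \<ge>
  1. Take \<open>c = y / x\<close>, integrate \<open>cross\<close> over \<open>t\<close> from 0 to
  \<open>x\<close>, and recognise the stretched integral as the one up to \<open>y\<close>, divided
  by \<open>c\<close>.\<close>

lemma elasticity_integral_antimono:
  fixes w :: "real \<Rightarrow> real"
  assumes cont: "continuous_on {0..} w"
    and cross: "\<And>c t x. 1 \<le> c \<Longrightarrow> 0 \<le> t \<Longrightarrow> t \<le> x \<Longrightarrow> w (c * x) * w t \<le> w x * w (c * t)"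
    and F: "\<And>x. x > 0 \<Longrightarrow> integral {0..x} w > 0"
    and xy: "0 < x" "x \<le> y"
  shows "y * w y / integral {0..y} w \<le> x * w x / integral {0..x} w"
proof -
  define c where "c = y / x"
  have c: "c \<ge> 1" "y = c * x"
    using xy by (auto simp: c_def)
  have int: "w integrable_on {0..z}" for z
    by (intro integrable_continuous_interval continuous_on_subset[OF cont]) auto
  have im: "(\<lambda>t. t / c) ` {0..y} = {0..x}"
    using c xy by (simp add: image_divide_atLeastAtMost)
  have sub: "integral {0..y} w = c * integral {0..x} (\<lambda>t. w (c * t))"
    using integral_stretch_real[of c 0 y w] c im by (simp add: field_simps)
  have cint: "(\<lambda>t. w (c * t)) integrable_on {0..x}"
    using c by (intro integrable_continuous_interval continuous_on_compose2[OF cont] continuous_intros) auto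
  have "w y * integral {0..x} w = integral {0..x} (\<lambda>t. w y * w t)"
    by simp
  also have "\<dots> \<le> integral {0..x} (\<lambda>t. w x * w (c * t))"
    using c cross int cint by (intro integral_le integrable_on_mult_right) auto
  finally have "w y * integral {0..x} w \<le> w x * integral {0..x} (\<lambda>t. w (c * t))"
    by simp
  then have "y * (w y * integral {0..x} w) \<le> y * (w x * integral {0..x} (\<lambda>t. w (c * t)))"
    using xy by (intro mult_left_mono) auto
  also have "\<dots> = x * w x * integral {0..y} w"
    by (simp add: sub) (simp add: c)
  finally show ?thesis
    using F[of x] F[of y] xy by (simp add: field_simps)
qed

subsection \<open>The generalised inverse hyperbolic sine\<close>

lemma one_plus_powr_pos: "1 + t powr q > (0::real)"
  using powr_ge_zero[of t q] by linarith

lemma arsinh_pq_integrand_continuous: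
  fixes p q :: real
  assumes "q > 0"
  shows "continuous_on {0..} (\<lambda>t::real. (1 + t powr q) powr (- 1 / p))"
proof -
  have "1 + t powr q \<noteq> 0" for t :: real
    using one_plus_powr_pos[of t q] by simp
  then show ?thesis
    using assms by (intro continuous_on_powr' continuous_intros) auto
qed

lemma arsinh_pq_has_derivative:
  assumes "q > 0" "x > 0"
  shows "(arsinh_pq p q has_real_derivative (1 + x powr q) powr (- 1 / p)) (at x)"
proof -
  \<comment> \<open>The right end \<open>x + 1\<close> makes \<open>x\<close> an interior point, so
    that the derivative within the interval is the full derivative.\<close>
  have "((\<lambda>x. integral {0..x} (\<lambda>t. (1 + t powr q) powr (- 1 / p))) has_real_derivative
      (1 + x powr q) powr (- 1 / p)) (at x within {0..x + 1})"
    using assms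
    by (intro integral_has_real_derivative
        continuous_on_subset[OF arsinh_pq_integrand_continuous]) auto
  moreover have "at x within {0..x + 1} = at x"
    using assms by (intro at_within_Icc_at) auto
  ultimately show ?thesis
    by (simp add: arsinh_pq_def[abs_def])
qed

lemma arsinh_pq_pos:
  assumes "q > 0" "x > 0"
  shows "arsinh_pq p q x > 0"
proof -
  have "continuous_on {0..x} (\<lambda>t::real. (1 + t powr q) powr (- 1 / p))"
    using assms by (intro continuous_on_subset[OF arsinh_pq_integrand_continuous]) auto
  \<comment> \<open>A continuous nonnegative integrand with integral 0 would vanish on the whole
    interval, but at 0 its value is 1.\<close>
  then have "integral {0..x} (\<lambda>t. (1 + t powr q) powr (- 1 / p)) \<noteq> 0"
    using integral_eq_0_iff[of 0 x "\<lambda>t. (1 + t powr q) powr (- 1 / p)"] assms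
      one_plus_powr_pos[of 0 q]
    by (auto dest!: bspec[of _ _ 0])
  moreover have "integral {0..x} (\<lambda>t. (1 + t powr q) powr (- 1 / p)) \<ge> 0"
    by (intro Henstock_Kurzweil_Integration.integral_nonneg integrable_continuous_interval
        continuous_on_subset[OF arsinh_pq_integrand_continuous]) (use assms in auto)
  ultimately show ?thesis
    by (simp add: arsinh_pq_def)
qed

lemma arsinh_pq_mono:
  assumes "q > 0" "0 < x" "x \<le> y"
  shows "arsinh_pq p q x \<le> arsinh_pq p q y"
  unfolding arsinh_pq_def
  using assms
  by (intro integral_subset_le integrable_continuous_interval
      continuous_on_subset[OF arsinh_pq_integrand_continuous]) auto

lemma arsinh_pq_integrand_cross:
  fixes p q :: real
  assumes "p > 0" "q > 0" "1 \<le> c" "0 \<le> t" "t \<le> x"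
  shows "(1 + (c * x) powr q) powr (- 1 / p) * (1 + t powr q) powr (- 1 / p)
    \<le> (1 + x powr q) powr (- 1 / p) * (1 + (c * t) powr q) powr (- 1 / p)"
proof -
  \<comment> \<open>This product is exactly the difference of the two sides of the next inequality.
    The negative exponent \<open>- 1 / p\<close> then reverses that inequality.\<close>
  have "(c powr q - 1) * (x powr q - t powr q) \<ge> 0"
    using assms powr_mono2[of q 1 c] by (intro mult_nonneg_nonneg) (auto intro: powr_mono2)
  then have "(1 + x powr q) * (1 + (c * t) powr q) \<le> (1 + (c * x) powr q) * (1 + t powr q)"
    by (simp add: powr_mult algebra_simps)
  moreover have "0 < (1 + x powr q) * (1 + (c * t) powr q)"
    by (intro mult_pos_pos one_plus_powr_pos)
  ultimately have "((1 + (c * x) powr q) * (1 + t powr q)) powr (- 1 / p)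
      \<le> ((1 + x powr q) * (1 + (c * t) powr q)) powr (- 1 / p)"
    using assms by (intro powr_mono2') auto
  then show ?thesis
    by (simp add: powr_mult)
qed

lemma arsinh_pq_elasticity_antimono:
  assumes "p > 0" "q > 0" "0 < x" "x \<le> y"
  shows "y * (1 + y powr q) powr (- 1 / p) / arsinh_pq p q y
    \<le> x * (1 + x powr q) powr (- 1 / p) / arsinh_pq p q x"
  unfolding arsinh_pq_def
proof (rule elasticity_integral_antimono)
  show "integral {0..x} (\<lambda>t. (1 + t powr q) powr (- 1 / p)) > 0" if "x > 0" for x
    using arsinh_pq_pos[of q x p] assms that by (simp add: arsinh_pq_def)
qed (use assms arsinh_pq_integrand_cross arsinh_pq_integrand_continuous in blast)+

text \<open>The intermediate order is 0 in the first case and \<open>b\<close> in the second: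
  concavity is applied at that order, and monotonicity of \<open>arsinh_pq\<close> and of power
  means covers the remaining change of order.\<close>

lemma arsinh_pq_power_mean_le:
  assumes pq: "p > 0" "q > 0"
    and ab: "(a \<ge> 0 \<and> 0 \<ge> b) \<or> (0 < b \<and> b \<le> a \<and> b \<le> 1)"
    and rs: "r > 0" "s > 0"
  shows "power_mean b (arsinh_pq p q r) (arsinh_pq p q s) \<le> arsinh_pq p q (power_mean a r s)"
  using ab
proof
  assume ab: "a \<ge> 0 \<and> 0 \<ge> b"
  have "power_mean b (arsinh_pq p q r) (arsinh_pq p q s) \<le> sqrt (arsinh_pq p q r * arsinh_pq p q s)"
    using ab pq rs by (intro power_mean_le_sqrt_mult arsinh_pq_pos) auto
  also have "\<dots> \<le> arsinh_pq p q (sqrt (r * s))"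
    using geometric_mean_concave_if_elasticity_antimono[OF arsinh_pq_has_derivative[OF pq(2)]
        arsinh_pq_pos[OF pq(2)] arsinh_pq_elasticity_antimono[OF pq] rs] by blast
  also have "\<dots> \<le> arsinh_pq p q (power_mean a r s)"
    using ab pq rs by (intro arsinh_pq_mono sqrt_mult_le_power_mean) auto
  finally show ?thesis .
next
  assume ab: "0 < b \<and> b \<le> a \<and> b \<le> 1"
  have "power_mean b (arsinh_pq p q r) (arsinh_pq p q s) \<le> arsinh_pq p q (power_mean b r s)"
  proof (rule power_mean_concave_if_elasticity_antimono[OF arsinh_pq_has_derivative[OF pq(2)]
        arsinh_pq_pos[OF pq(2)] _ _ arsinh_pq_elasticity_antimono[OF pq]])
    show "(1 + x powr q) powr (- 1 / p) > 0" for x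
      using one_plus_powr_pos[of x q] by simp
    show "(1 + y powr q) powr (- 1 / p) \<le> (1 + x powr q) powr (- 1 / p)"
      if "0 < x" "x \<le> y" for x y
      using that pq one_plus_powr_pos[of x q] by (intro powr_mono2') (auto intro: powr_mono2)
  qed (use ab rs in auto)
  also have "\<dots> \<le> arsinh_pq p q (power_mean a r s)"
    using ab pq rs by (intro arsinh_pq_mono power_mean_mono_pos power_mean_pos) auto
  finally show ?thesis .
qed

theorem theorem4:
  fixes p q a b :: real
  assumes "p > 1" and "q > 1"
    and "(a \<ge> 0 \<and> 0 \<ge> b) \<or> (0 < b \<and> b \<le> a \<and> a \<le> 1)"
  shows "power_mean_concave_on a b {0<..} (arsinh_pq p q)
    \<and> (p = q \<longrightarrow> power_mean_concave_on a b {0<..} (arsinh_p p))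
    \<and> (\<forall>r\<in>{0<..}. \<forall>s\<in>{0<..}.
         arsinh_pq p q (power_mean a r s) \<ge> power_mean b (arsinh_pq p q r) (arsinh_pq p q s))"
proof -
  have pq: "p > 0" "q > 0"
    using assms by auto
  have le: "power_mean b (arsinh_pq p q r) (arsinh_pq p q s) \<le> arsinh_pq p q (power_mean a r s)"
    if "r > 0" "s > 0" for r s
    using assms(3) pq that by (intro arsinh_pq_power_mean_le) auto
  have "continuous_on {0<..} (arsinh_pq p q)"
    using DERIV_isCont[OF arsinh_pq_has_derivative[OF pq(2)]]
    by (intro continuous_at_imp_continuous_on) blast
  then have "power_mean_concave_on a b {0<..} (arsinh_pq p q)"
    using le pq by (auto simp: power_mean_concave_on_def is_interval_1 arsinh_pq_pos)
  then show ?thesis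
    using le by (auto simp: arsinh_p_def)
qed

end
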